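(* Let $V=V_1\oplus\cdots\oplus V_b$ with each $V_i\cong\mathbb{F}_2^s$. Let $\circ$ and $\diamond$ be two parallel alternative operations on $V$, defined componentwise by alternative operations $\circ_1,\dots,\circ_b$ and $\diamond_1,\dots,\diamond_b$ on $V_1,\dots,V_b$ respectively, such that $\dim W_{\circ_i}=\dim W_{\diamond_i}=s-2$ for all $i$. Then there exists $g\in\mathrm{GL}(V)$ such that $T_\diamond=T_\circ^g$.
   Context: Vectors are row vectors and maps are written in postfix notation. For a vector space $X$ over $\mathbb{F}_2$, an alternative operation on $X$ is defined from an elementary abelian $2$-subgroup $T<\mathrm{AGL}(X,+)$ acting regularly on $X$: writing $\tau_a$ for the unique element of $T$ with $0\tau_a=a$, set $a\circ b:=a\tau_b$; the translation group of $\circ$ is $T_\circ=T$. It is assumed that the xor-translations $x\mapsto x+a$ are affine with respect to $\circ$, i.e. lie in the normaliser of $T_\circ$ in $\mathrm{Sym}(X)$. The weak key space is $W_\circ=\{k: x\circ k=x+k\ \forall x\}$. An alternative operation $\circ$ on $V=V_1\oplus\cdots\oplus V_b$ is parallel, defined by alternative operations $\circ_j$ on $V_j$, if $(x_1,\dots,x_b)\circ(y_1,\dots,y_b)=(x_1\circ_1y_1,\dots,x_b\circ_by_b)$ for all $x_j,y_j\in V_j$. For a subgroup $T$ and $g\in\mathrm{GL}(V)$, $T^g:=gTg^{-1}$. *)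

theory Defs
  imports "HOL-Analysis.Analysis" "HOL-Library.Z2"
begin

text \<open>Vectors over F_2: the type bit ^ 'n (row vectors; maps written as functions,
  so the postfix product "x g h" is (h o g) x).\<close>

type_synonym 'n f2vec = "bit ^ 'n"

text \<open>General linear group GL(X): bijective F_2-linear maps.\<close>
definition GLmaps :: "('n::finite f2vec \<Rightarrow> 'n f2vec) set" where
  "GLmaps = {g. bij g \<and> Vector_Spaces.linear (*s) (*s) g}"

text \<open>Affine general linear group AGL(X,+): x \<mapsto> x L + c with L in GL(X).\<close>
definition AGLmaps :: "('n::finite f2vec \<Rightarrow> 'n f2vec) set" where
  "AGLmaps = {f. \<exists>L c. L \<in> GLmaps \<and> f = (\<lambda>x. L x + c)}"

text \<open>T is an elementary abelian 2-subgroup of AGL(X,+) acting regularly on X,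
  such that all xor-translations x \<mapsto> x + a lie in the normaliser of T in Sym(X).\<close>
definition alt_tgroup :: "('n::finite f2vec \<Rightarrow> 'n f2vec) set \<Rightarrow> bool" where
  "alt_tgroup T \<longleftrightarrow>
     T \<subseteq> AGLmaps \<and> id \<in> T \<and>
     (\<forall>t\<in>T. \<forall>u\<in>T. t \<circ> u \<in> T) \<and>
     (\<forall>t\<in>T. inv t \<in> T) \<and>
     (\<forall>t\<in>T. \<forall>u\<in>T. t \<circ> u = u \<circ> t) \<and>
     (\<forall>t\<in>T. t \<circ> t = id) \<and>
     (\<forall>a. \<exists>!t. t \<in> T \<and> t 0 = a) \<and>
     (\<forall>a. (\<lambda>t. (\<lambda>x. x + a) \<circ> t \<circ> inv (\<lambda>x. x + a)) ` T = T)"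

text \<open>The operation defined by T: a \<circ> b = a \<tau>_b, \<tau>_b the unique element of T with 0 \<tau>_b = b.\<close>
definition op_of :: "('n::finite f2vec \<Rightarrow> 'n f2vec) set \<Rightarrow> 'n f2vec \<Rightarrow> 'n f2vec \<Rightarrow> 'n f2vec" where
  "op_of T a b = (THE t. t \<in> T \<and> t 0 = b) a"

definition is_alt_op :: "('n::finite f2vec \<Rightarrow> 'n f2vec \<Rightarrow> 'n f2vec) \<Rightarrow> bool" where
  "is_alt_op circ \<longleftrightarrow> (\<exists>T. alt_tgroup T \<and> circ = op_of T)"

text \<open>Translation group T_\<circ> = {\<tau>_b : b \<in> X}, where x \<tau>_b = x \<circ> b.\<close>
definition transl :: "('n::finite f2vec \<Rightarrow> 'n f2vec \<Rightarrow> 'n f2vec) \<Rightarrow> ('n f2vec \<Rightarrow> 'n f2vec) set" where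
  "transl circ = {(\<lambda>x. circ x b) | b. True}"

text \<open>Weak key space W_\<circ>.\<close>
definition weak_keys :: "('n::finite f2vec \<Rightarrow> 'n f2vec \<Rightarrow> 'n f2vec) \<Rightarrow> 'n f2vec set" where
  "weak_keys circ = {k. \<forall>x. circ x k = x + k}"

text \<open>V = V_1 \<oplus> ... \<oplus> V_b with V_j = F_2^s realised as bit ^ ('b \<times> 's);
  the j-th block of x is (x(j,k))_k.\<close>
definition blk :: "('b::finite \<times> 's::finite) f2vec \<Rightarrow> 'b \<Rightarrow> 's f2vec" where
  "blk x j = (\<chi> k. x $ (j, k))"

definition par_op :: "('b::finite \<Rightarrow> ('s::finite f2vec \<Rightarrow> 's f2vec \<Rightarrow> 's f2vec))
     \<Rightarrow> ('b \<times> 's) f2vec \<Rightarrow> ('b \<times> 's) f2vec \<Rightarrow> ('b \<times> 's) f2vec" where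
  "par_op ops x y = (\<chi> p. (ops (fst p) (blk x (fst p)) (blk y (fst p))) $ snd p)"

text \<open>T^g = g T g^{-1} in postfix notation, i.e. x \<mapsto> ((x g) t) g^{-1}.\<close>
definition conjgrp :: "('n \<Rightarrow> 'n) \<Rightarrow> ('n \<Rightarrow> 'n) set \<Rightarrow> ('n \<Rightarrow> 'n) set" where
  "conjgrp g T = (\<lambda>t. inv g \<circ> t \<circ> g) ` T"

end

theory Submission
  imports Defs
begin

(* Write x \<circ> a = x + a + D a x. Since the translations of \<circ> form an elementary abelian group
  normalised by the xor-translations, the defect D is an alternating, symmetric, bilinear map
  whose values lie in its radical, and that radical is the weak key space. If the radical W has
  codimension 2, pick e1, e2 spanning a complement; then D e1 e2 is a nonzero vector of W, and
  on a basis e1, e2, K of the space with D e1 e2 \<in> K \<subseteq> W the form vanishes except for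
  D e1 e2 = D e2 e1. Hence any two such forms are isomorphic through the linear map matching
  adapted bases, and this map carries one operation to the other and so conjugates their
  translation groups. For parallel operations the blockwise maps assemble into one. *)

lemma bit_add_self [simp]: "(b::bit) + b = 0"
  by (cases b) auto

lemma f2vec_add_self [simp]: "(x::'n::finite f2vec) + x = 0"
  by (simp add: vec_eq_iff)

lemma f2vec_add_self_left [simp]: "(x::'n::finite f2vec) + (x + y) = y"
  by (simp add: add.assoc[symmetric])

lemma additive_imp_linear_f2vec:
  fixes f :: "'n::finite f2vec \<Rightarrow> 'm::finite f2vec"
  assumes "\<And>x y. f (x + y) = f x + f y"
  shows "Vector_Spaces.linear (*s) (*s) f"
proof -
  have "f 0 = 0" using assms[of 0 0] by simp
  then have "f (c *s x) = c *s f x" for c :: bit and x by (cases c) auto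
  then show ?thesis unfolding Vector_Spaces.linear_iff
    by (intro conjI allI vec.vector_space_axioms assms) auto
qed

lemma f2vec_add_eq_0_iff: "(x::'n::finite f2vec) + y = 0 \<longleftrightarrow> x = y"
  by (metis f2vec_add_self f2vec_add_self_left add_0_right)

lemma exists_complement_pair:
  fixes S :: "('a::field ^ 'n::finite) set"
  assumes "vec.dim S + 2 = CARD('n)"
  shows "\<exists>e1 e2. e1 \<notin> vec.span S \<and> e2 \<notin> vec.span (insert e1 S)
    \<and> vec.span (insert e2 (insert e1 S)) = UNIV"
proof -
  have full: "vec.span X = UNIV \<longleftrightarrow> vec.dim X = CARD('n)" for X :: "('a ^ 'n) set"
    using vec.dim_eq_full[of X] by (simp add: vec.dimension_def card_cart_basis)
  obtain e1 where e1: "e1 \<notin> vec.span S"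
    using full[of S] assms by auto
  have dim1: "vec.dim (insert e1 S) = vec.dim S + 1"
    using e1 by (simp add: vec.dim_insert)
  obtain e2 where e2: "e2 \<notin> vec.span (insert e1 S)"
    using full[of "insert e1 S"] dim1 assms by auto
  have "vec.dim (insert e2 (insert e1 S)) = CARD('n)"
    using e2 dim1 assms by (simp add: vec.dim_insert)
  then show ?thesis using e1 e2 full by blast
qed

lemma exists_linear_matching_frames:
  fixes e1 e2 w0 f1 f2 v0 :: "'a::field ^ 'n::finite"
  assumes indep: "vec.independent (insert f2 (insert f1 K'))"
    and "f1 \<notin> K'" "f2 \<notin> K'" "f1 \<noteq> f2" "v0 \<in> K'" "w0 \<in> K"
    and "finite K" "card K' = card K"
  shows "\<exists>g. Vector_Spaces.linear (*s) (*s) g \<and>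
    g f1 = e1 \<and> g f2 = e2 \<and> g v0 = w0 \<and> g ` K' = K"
proof -
  have "finite K'" using vec.finiteI_independent[OF indep] by simp
  then have "card (K' - {v0}) = card (K - {w0})"
    using assms(5-8) by (simp add: card_Diff_singleton)
  then obtain \<phi> where \<phi>: "bij_betw \<phi> (K' - {v0}) (K - {w0})"
    using finite_same_card_bij[of "K' - {v0}" "K - {w0}"] \<open>finite K'\<close> \<open>finite K\<close> by auto
  define h where
    "h b = (if b = f1 then e1 else if b = f2 then e2 else if b = v0 then w0 else \<phi> b)" for b
  obtain g where lin: "Vector_Spaces.linear (*s) (*s) g"
    and gh: "\<forall>b\<in>insert f2 (insert f1 K'). g b = h b"
    using vec.linear_independent_extend[OF indep] by blast
  have g: "g f1 = e1" "g f2 = e2" "g v0 = w0"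
    using gh assms(2-5) unfolding h_def by auto
  have g\<phi>: "g k = \<phi> k" if "k \<in> K' - {v0}" for k
    using gh that assms(2,3) unfolding h_def by auto
  have "g ` K' = insert (g v0) (g ` (K' - {v0}))" using assms(5) by blast
  also have "g ` (K' - {v0}) = \<phi> ` (K' - {v0})"
    using g\<phi> by (rule image_cong[OF refl])
  also have "\<dots> = K - {w0}"
    using bij_betw_imp_surj_on[OF \<phi>] .
  also have "insert (g v0) (K - {w0}) = K"
    using g(3) assms(6) by blast
  finally show ?thesis using lin g by blast
qed

lemma GLmapsI_span_image:
  fixes g :: "'n::finite f2vec \<Rightarrow> 'n f2vec"
  assumes lin: "Vector_Spaces.linear (*s) (*s) g" and span: "vec.span (g ` B) = UNIV"
  shows "g \<in> GLmaps"
proof -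
  have "surj g" using span vec.linear_span_image[OF lin, of B] by auto
  then have "bij g" using vec.linear_surj_imp_inj[OF lin] by (simp add: bij_def)
  then show ?thesis using lin unfolding GLmaps_def by blast
qed

lemma bilinear_eq_on_span:
  fixes f g :: "'a::field ^ 'n::finite \<Rightarrow> 'a ^ 'n \<Rightarrow> 'a ^ 'm::finite"
  assumes "\<And>a. Vector_Spaces.linear (*s) (*s) (f a)"
    and "\<And>x. Vector_Spaces.linear (*s) (*s) (\<lambda>a. f a x)"
    and "\<And>a. Vector_Spaces.linear (*s) (*s) (g a)"
    and "\<And>x. Vector_Spaces.linear (*s) (*s) (\<lambda>a. g a x)"
    and eq: "\<And>a x. a \<in> B \<Longrightarrow> x \<in> B \<Longrightarrow> f a x = g a x"
    and span: "vec.span B = UNIV"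
  shows "f a x = g a x"
proof -
  have "f b x = g b x" if "b \<in> B" for b
    using vec.linear_eq_on[OF assms(1,3), of x B] eq[OF that] span by blast
  then show ?thesis
    using vec.linear_eq_on[OF assms(2,4), of a B] span by blast
qed

lemma
  assumes "alt_tgroup T"
  shows alt_tgroup_AGLmaps: "T \<subseteq> AGLmaps"
    and alt_tgroup_comp: "\<forall>t\<in>T. \<forall>u\<in>T. t \<circ> u \<in> T"
    and alt_tgroup_commute: "\<forall>t\<in>T. \<forall>u\<in>T. t \<circ> u = u \<circ> t"
    and alt_tgroup_involution: "\<forall>t\<in>T. t \<circ> t = id"
    and alt_tgroup_ex1: "\<forall>a. \<exists>!t. t \<in> T \<and> t 0 = a"
    and alt_tgroup_xor_conj: "\<forall>a. (\<lambda>t. (\<lambda>x. x + a) \<circ> t \<circ> inv (\<lambda>x. x + a)) ` T = T"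
  using assms by (simp_all add: alt_tgroup_def)

lemma op_of_in_tgroup: "alt_tgroup T \<Longrightarrow> (\<lambda>x. op_of T x a) \<in> T"
  and op_of_zero_left: "alt_tgroup T \<Longrightarrow> op_of T 0 a = a"
  using theI'[OF alt_tgroup_ex1[THEN spec], of T a] unfolding op_of_def by simp_all

lemma alt_tgroup_eq_op_of:
  assumes "alt_tgroup T" "t \<in> T"
  shows "t = (\<lambda>x. op_of T x (t 0))"
  using the1_equality[OF alt_tgroup_ex1[OF assms(1), THEN spec], of t] assms(2)
  unfolding op_of_def by simp

lemma alt_tgroup_comp_op_of:
  assumes "alt_tgroup T" "t \<in> T"
  shows "t (op_of T x a) = op_of T x (t a)"
proof -
  have "t \<circ> (\<lambda>x. op_of T x a) \<in> T"
    using alt_tgroup_comp[OF assms(1)] op_of_in_tgroup[OF assms(1)] assms(2) by blast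
  from alt_tgroup_eq_op_of[OF assms(1) this] show ?thesis
    by (simp add: op_of_zero_left[OF assms(1)] fun_eq_iff)
qed

lemma op_of_assoc: "alt_tgroup T \<Longrightarrow> op_of T (op_of T x b) a = op_of T x (op_of T b a)"
  by (rule alt_tgroup_comp_op_of[OF _ op_of_in_tgroup])

lemma op_of_commute:
  assumes "alt_tgroup T"
  shows "op_of T a b = op_of T b a"
proof -
  have "(\<lambda>x. op_of T x b) \<circ> (\<lambda>x. op_of T x a) = (\<lambda>x. op_of T x a) \<circ> (\<lambda>x. op_of T x b)"
    using alt_tgroup_commute[OF assms] op_of_in_tgroup[OF assms] by blast
  from fun_cong[OF this, of 0] show ?thesis by (simp add: op_of_zero_left[OF assms])
qed

lemma op_of_cancel:
  assumes "alt_tgroup T"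
  shows "op_of T (op_of T x a) a = x"
proof -
  have "(\<lambda>x. op_of T x a) \<circ> (\<lambda>x. op_of T x a) = id"
    using alt_tgroup_involution[OF assms] op_of_in_tgroup[OF assms] by blast
  from fun_cong[OF this, of x] show ?thesis by simp
qed

lemma op_of_xor_conj:
  assumes "alt_tgroup T"
  shows "op_of T (x + c) a + c = op_of T x (op_of T c a + c)"
proof -
  have inv: "inv (\<lambda>x. x + c) = (\<lambda>x::'a f2vec. x + c)"
    by (rule inv_equality) (simp_all add: add.assoc)
  have "(\<lambda>x. x + c) \<circ> (\<lambda>x. op_of T x a) \<circ> inv (\<lambda>x. x + c) \<in> T"
    using alt_tgroup_xor_conj[OF assms, THEN spec, of c] op_of_in_tgroup[OF assms] by blast
  from alt_tgroup_eq_op_of[OF assms this] show ?thesis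
    unfolding inv by (simp add: fun_eq_iff)
qed

definition defect ::
    "('n::finite f2vec \<Rightarrow> 'n f2vec \<Rightarrow> 'n f2vec) \<Rightarrow> 'n f2vec \<Rightarrow> 'n f2vec \<Rightarrow> 'n f2vec"
  where "defect op a x = op x a + x + a"

definition radical :: "('n::finite f2vec \<Rightarrow> 'n f2vec \<Rightarrow> 'n f2vec) \<Rightarrow> 'n f2vec set"
  where "radical D = {k. \<forall>x. D k x = 0}"

lemma op_eq_defect: "op x a = x + a + defect op a x"
  unfolding defect_def by (simp add: add_ac)

lemma weak_keys_eq_radical: "weak_keys op = radical (defect op)"
proof -
  have "op x k = x + k \<longleftrightarrow> defect op k x = 0" for x k
    unfolding defect_def by (metis f2vec_add_eq_0_iff add.assoc)
  then show ?thesis unfolding weak_keys_def radical_def by blast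
qed

locale defect_form =
  fixes D :: "'n::finite f2vec \<Rightarrow> 'n f2vec \<Rightarrow> 'n f2vec"
  assumes linear_right: "Vector_Spaces.linear (*s) (*s) (D a)"
    and add_left: "D (a + b) x = D a x + D b x"
    and commute: "D a b = D b a"
    and self_zero: "D a a = 0"
    and range_radical: "D (D a b) x = 0"

(* The hypotheses are the group laws of the operation (commutativity, x \<circ> a \<circ> a = x, normality
  under xor-translations, associativity) rewritten in terms of D; additivity in the first
  argument is not among them and has to be derived. *)
lemma defect_formI:
  fixes D :: "'n::finite f2vec \<Rightarrow> 'n f2vec \<Rightarrow> 'n f2vec"
  assumes lin: "\<And>a. Vector_Spaces.linear (*s) (*s) (D a)"
    and commute: "\<And>a b. D a b = D b a"
    and self_zero: "\<And>a. D a a = 0"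
    and cancel: "\<And>a x. D a (D a x) = 0"
    and shift: "\<And>a c x. D (a + D a c) x = D a x"
    and compose: "\<And>a b x. D (a + b + D a b) x = D b x + D a x + D a (D b x)"
  shows "defect_form D"
proof (rule defect_form.intro)
  have radical_right: "D a w = 0" if "\<forall>x. D w x = 0" for a w
    using commute that by metis
  have range: "D (D a c) x = 0" for a c x
  proof -
    define b where "b = D a c"
    have "D a x = D b x + D a x + D a (D b x)"
      using compose[of a b x] shift[of a c x] by (simp add: b_def cancel)
    then have "D b x = D a (D b x)"
      by (simp add: add_ac f2vec_add_eq_0_iff)
    then have "D b x = D a (D a (D b x))" by simp
    then show ?thesis using cancel b_def by simp
  qed
  show "D (D a c) x = 0" for a c x by (rule range)
  show "D (a + b) x = D a x + D b x" for a b x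
  proof -
    have "D (a + b + D a b) x = D (a + b) x"
      using compose[of "D a b" "a + b" x] by (simp add: range add_ac)
    moreover have "D a (D b x) = 0" using radical_right range by blast
    ultimately show ?thesis using compose[of a b x] by (simp add: add_ac)
  qed
qed (use lin commute self_zero in auto)

lemma linear_defect_op_of:
  assumes "alt_tgroup T"
  shows "Vector_Spaces.linear (*s) (*s) (defect (op_of T) a)"
proof -
  have "(\<lambda>x. op_of T x a) \<in> AGLmaps"
    using alt_tgroup_AGLmaps[OF assms] op_of_in_tgroup[OF assms] by blast
  then obtain L c where L: "L \<in> GLmaps" and "(\<lambda>x. op_of T x a) = (\<lambda>x. L x + c)"
    unfolding AGLmaps_def by blast
  then have op: "op_of T x a = L x + c" for x by metis
  have lin: "Vector_Spaces.linear (*s) (*s) L" using L GLmaps_def by blast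
  have "c = a" using op[of 0] op_of_zero_left[OF assms] vec.linear_0[OF lin] by simp
  then have "defect (op_of T) a x = L x + x" for x
    unfolding defect_def op by (simp add: add_ac)
  then show ?thesis
    by (intro additive_imp_linear_f2vec) (simp add: vec.linear_add[OF lin] add_ac)
qed

lemma defect_form_op_of:
  assumes T: "alt_tgroup T"
  shows "defect_form (defect (op_of T))"
proof -
  define D where "D = defect (op_of T)"
  have expand: "op_of T x a = x + a + D a x" for x a
    unfolding D_def by (rule op_eq_defect)
  have lin: "Vector_Spaces.linear (*s) (*s) (D a)" for a
    unfolding D_def by (rule linear_defect_op_of[OF T])
  have add: "D a (x + y) = D a x + D a y" and zero: "D a 0 = 0" for a x y
    using vec.linear_add[OF lin] vec.linear_0[OF lin] by blast+
  have "defect_form D"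
  proof (rule defect_formI)
    show "D a b = D b a" for a b
      using op_of_commute[OF T, of a b] unfolding expand by (simp add: add_ac)
    show self_zero: "D a a = 0" for a
      using op_of_cancel[OF T, of 0 a] unfolding expand by (simp add: zero)
    show "D a (D a x) = 0" for a x
      using op_of_cancel[OF T, of x a] unfolding expand by (simp add: add self_zero add_ac)
    show "D (a + D a c) x = D a x" for a c x
      using op_of_xor_conj[OF T, of x c a] unfolding expand by (simp add: add add_ac)
    show "D (a + b + D a b) x = D b x + D a x + D a (D b x)" for a b x
      using op_of_assoc[OF T, of x b a] unfolding expand by (simp add: add add_ac)
  qed (rule lin)
  then show ?thesis unfolding D_def .
qed

lemma defect_form_alt_op: "is_alt_op op \<Longrightarrow> defect_form (defect op)"
  unfolding is_alt_op_def using defect_form_op_of by blast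

definition adapted_basis ::
    "('n::finite f2vec \<Rightarrow> 'n f2vec \<Rightarrow> 'n f2vec) \<Rightarrow> 'n f2vec \<Rightarrow> 'n f2vec \<Rightarrow> 'n f2vec set \<Rightarrow> bool"
  where "adapted_basis D e1 e2 K \<longleftrightarrow>
    K \<subseteq> radical D \<and> D e1 e2 \<in> K \<and> e1 \<notin> radical D \<and> e2 \<notin> radical D \<and>
    vec.independent (insert e2 (insert e1 K)) \<and> vec.span (insert e2 (insert e1 K)) = UNIV"

lemma
  assumes "adapted_basis D e1 e2 K"
  shows adapted_basis_subset_radical: "K \<subseteq> radical D"
    and adapted_basis_defect_mem: "D e1 e2 \<in> K"
    and adapted_basis_not_radical: "e1 \<notin> radical D" "e2 \<notin> radical D"
    and adapted_basis_independent: "vec.independent (insert e2 (insert e1 K))"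
    and adapted_basis_span: "vec.span (insert e2 (insert e1 K)) = UNIV"
  using assms unfolding adapted_basis_def by simp_all

context defect_form
begin

lemma zero_left: "D 0 x = 0"
  using add_left[of 0 0 x] by simp

lemma subspace_radical: "vec.subspace (radical D)"
  unfolding vec.subspace_def radical_def
proof (intro conjI ballI allI)
  fix c :: bit and k :: "'n f2vec" assume "k \<in> {k. \<forall>x. D k x = 0}"
  moreover have "c *s k = 0 \<or> c *s k = k" by (cases c) simp_all
  ultimately show "c *s k \<in> {k. \<forall>x. D k x = 0}" using zero_left by auto
qed (auto simp: zero_left add_left)

lemma defect_nonzero:
  assumes span: "vec.span (insert e2 (insert e1 (radical D))) = UNIV" and e1: "e1 \<notin> radical D"
  shows "D e1 e2 \<noteq> 0"
proof
  assume e12: "D e1 e2 = 0"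
  have on_spanning: "D e1 b = 0" if "b \<in> insert e2 (insert e1 (radical D))" for b
    using that e12 self_zero commute[of e1 b] unfolding radical_def by auto
  have "D e1 x = (\<lambda>y. 0) x" for x
    by (rule vec.linear_eq_on[OF linear_right vec.linear_zero,
          where B = "insert e2 (insert e1 (radical D))"]) (simp_all add: span on_spanning)
  then show False using e1 unfolding radical_def by simp
qed

lemma exists_adapted_basis:
  assumes "vec.dim (radical D) + 2 = CARD('n)"
  shows "\<exists>e1 e2 K. adapted_basis D e1 e2 K"
proof -
  let ?W = "radical D"
  have span_W: "vec.span ?W = ?W" using subspace_radical by (rule vec.span_eq_iff[THEN iffD2])
  obtain e1 e2 where e1: "e1 \<notin> ?W" and e2: "e2 \<notin> vec.span (insert e1 ?W)"
    and full: "vec.span (insert e2 (insert e1 ?W)) = UNIV"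
    using exists_complement_pair[OF assms] span_W by metis
  have e2_W: "e2 \<notin> ?W" using e2 vec.span_superset by blast
  have w0: "D e1 e2 \<in> ?W" "D e1 e2 \<noteq> 0"
    using range_radical defect_nonzero[OF full e1] unfolding radical_def by auto
  then have "vec.independent {D e1 e2}" by (simp add: vec.independent_insert)
  then obtain K where K: "D e1 e2 \<in> K" "K \<subseteq> ?W" "vec.independent K" "?W \<subseteq> vec.span K"
    using vec.maximal_independent_subset_extend[of "{D e1 e2}" ?W] w0 by auto
  have span_K: "vec.span K = ?W" using vec.span_mono[OF K(2)] K(4) span_W by blast
  have span_e1: "vec.span (insert e1 K) = vec.span (insert e1 ?W)"
    by (simp add: vec.span_insert span_K span_W)
  have "vec.span (insert e2 (insert e1 K)) = UNIV"
    using full by (simp add: vec.span_insert[of e2] span_e1)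
  moreover have "vec.independent (insert e2 (insert e1 K))"
    using K(3) e1 e2 span_K span_e1 by (intro vec.independent_insertI) auto
  ultimately show ?thesis
    unfolding adapted_basis_def using K(1,2) e1 e2_W by blast
qed

lemma adapted_basis_neq:
  assumes adapted: "adapted_basis D e1 e2 K"
  shows "e1 \<noteq> e2"
proof
  assume "e1 = e2"
  then have "0 \<in> insert e2 (insert e1 K)"
    using adapted_basis_defect_mem[OF adapted] self_zero by simp
  then show False using adapted_basis_independent[OF adapted] by (simp add: vec.dependent_zero)
qed

lemma
  assumes adapted: "adapted_basis D e1 e2 K"
  shows finite_adapted_basis: "finite K"
    and card_adapted_basis: "card K + 2 = CARD('n)"
proof -
  let ?B = "insert e2 (insert e1 K)"
  note indep = adapted_basis_independent[OF adapted]
    and span = adapted_basis_span[OF adapted]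
  show "finite K" using vec.finiteI_independent[OF indep] by simp
  have "card ?B = vec.dim (UNIV :: 'n f2vec set)"
    by (rule vec.basis_card_eq_dim) (use indep span in simp_all)
  moreover have "e1 \<notin> K" "e2 \<notin> K"
    using adapted_basis_subset_radical[OF adapted] adapted_basis_not_radical[OF adapted] by blast+
  ultimately show "card K + 2 = CARD('n)"
    using adapted_basis_neq[OF adapted] \<open>finite K\<close> vec_dim_card by simp
qed

end

lemma adapted_bases_isomorphic:
  fixes D E :: "'n::finite f2vec \<Rightarrow> 'n f2vec \<Rightarrow> 'n f2vec"
  assumes D: "defect_form D" and E: "defect_form E"
    and DK: "adapted_basis D e1 e2 K" and EK: "adapted_basis E f1 f2 K'"
  shows "\<exists>g\<in>GLmaps. \<forall>a x. g (E a x) = D (g a) (g x)"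
proof -
  let ?B' = "insert f2 (insert f1 K')"
  have "f1 \<notin> K'" "f2 \<notin> K'"
    using adapted_basis_subset_radical[OF EK] adapted_basis_not_radical[OF EK] by blast+
  moreover have "card K' = card K"
    using defect_form.card_adapted_basis[OF D DK] defect_form.card_adapted_basis[OF E EK] by simp
  ultimately obtain g where lin: "Vector_Spaces.linear (*s) (*s) g"
    and g: "g f1 = e1" "g f2 = e2" "g (E f1 f2) = D e1 e2" "g ` K' = K"
    using exists_linear_matching_frames[OF adapted_basis_independent[OF EK]]
      defect_form.adapted_basis_neq[OF E EK] adapted_basis_defect_mem[OF EK]
      adapted_basis_defect_mem[OF DK] defect_form.finite_adapted_basis[OF D DK]
    by metis
  have "g ` ?B' = insert e2 (insert e1 K)" using g by auto
  then have GL: "g \<in> GLmaps"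
    using GLmapsI_span_image[OF lin] adapted_basis_span[OF DK] by metis
  have g0: "g 0 = 0" using vec.linear_0[OF lin] .
  have rad: "E k x = 0" "D (g k) y = 0" if "k \<in> K'" for k x y
    using that g(4) adapted_basis_subset_radical[OF DK] adapted_basis_subset_radical[OF EK]
    unfolding radical_def by blast+
  have on_basis: "g (E a x) = D (g a) (g x)" if a: "a \<in> ?B'" and x: "x \<in> ?B'" for a x
  proof -
    consider "a \<in> K'" | "x \<in> K'" | "a = x" | "a = f1" "x = f2" | "a = f2" "x = f1"
      using a x by blast
    then show ?thesis
    proof cases
      case 1 then show ?thesis using rad g0 by simp
    next
      case 2 then show ?thesis
        using rad g0 defect_form.commute[OF E, of a x] defect_form.commute[OF D, of "g a" "g x"]
        by simp
    next
      case 3 then show ?thesis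
        using g0 defect_form.self_zero[OF D] defect_form.self_zero[OF E] by simp
    next
      case 4 then show ?thesis using g by simp
    next
      case 5 then show ?thesis
        using g defect_form.commute[OF D, of e1 e2] defect_form.commute[OF E, of f1 f2] by simp
    qed
  qed
  have "g (E a x) = D (g a) (g x)" for a x
  proof (rule bilinear_eq_on_span[where f = "\<lambda>a x. g (E a x)" and g = "\<lambda>a x. D (g a) (g x)"
        and B = ?B'])
    show "Vector_Spaces.linear (*s) (*s) (\<lambda>x. g (E a x))" for a
      using Vector_Spaces.linear_compose[OF defect_form.linear_right[OF E] lin] by (simp add: o_def)
    show "Vector_Spaces.linear (*s) (*s) (\<lambda>x. D (g a) (g x))" for a
      using Vector_Spaces.linear_compose[OF lin defect_form.linear_right[OF D]] by (simp add: o_def)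
    show "Vector_Spaces.linear (*s) (*s) (\<lambda>a. g (E a x))" for x
      by (rule additive_imp_linear_f2vec) (simp add: defect_form.add_left[OF E] vec.linear_add[OF lin])
    show "Vector_Spaces.linear (*s) (*s) (\<lambda>a. D (g a) (g x))" for x
      by (rule additive_imp_linear_f2vec) (simp add: defect_form.add_left[OF D] vec.linear_add[OF lin])
  qed (use on_basis adapted_basis_span[OF EK] in auto)
  then show ?thesis using GL by blast
qed

lemma alt_ops_isomorphic:
  fixes c d :: "'n::finite f2vec \<Rightarrow> 'n f2vec \<Rightarrow> 'n f2vec"
  assumes c: "is_alt_op c" and d: "is_alt_op d"
    and "vec.dim (weak_keys c) + 2 = CARD('n)" "vec.dim (weak_keys d) + 2 = CARD('n)"
  shows "\<exists>g\<in>GLmaps. \<forall>x a. g (d x a) = c (g x) (g a)"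
proof -
  note forms = defect_form_alt_op[OF c] defect_form_alt_op[OF d]
  obtain e1 e2 K f1 f2 K' where "adapted_basis (defect c) e1 e2 K" "adapted_basis (defect d) f1 f2 K'"
    using defect_form.exists_adapted_basis[OF forms(1)] defect_form.exists_adapted_basis[OF forms(2)]
      assms(3,4) unfolding weak_keys_eq_radical by meson
  then obtain g where g: "g \<in> GLmaps" and hom: "\<And>a x. g (defect d a x) = defect c (g a) (g x)"
    using adapted_bases_isomorphic[OF forms] by blast
  have lin: "Vector_Spaces.linear (*s) (*s) g" using g GLmaps_def by blast
  have "g (d x a) = c (g x) (g a)" for x a
    by (subst (1 2) op_eq_defect) (simp add: vec.linear_add[OF lin] hom)
  then show ?thesis using g by blast
qed

lemma blk_eq_iff: "x = y \<longleftrightarrow> (\<forall>j. blk x j = blk y j)"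
  unfolding blk_def vec_eq_iff by auto

lemma blk_add: "blk (x + y) j = blk x j + blk y j"
  unfolding blk_def by (simp add: vec_eq_iff)

lemma blk_vec_lambda: "blk (\<chi> p. f (fst p) $ snd p) j = f j"
  unfolding blk_def by (simp add: vec_eq_iff)

lemma blk_par_op: "blk (par_op ops x y) j = ops j (blk x j) (blk y j)"
  unfolding par_op_def by (rule blk_vec_lambda)

definition blockwise ::
    "('b::finite \<Rightarrow> 's::finite f2vec \<Rightarrow> 's f2vec) \<Rightarrow> ('b \<times> 's) f2vec \<Rightarrow> ('b \<times> 's) f2vec"
  where "blockwise g x = (\<chi> p. g (fst p) (blk x (fst p)) $ snd p)"

lemma blk_blockwise: "blk (blockwise g x) j = g j (blk x j)"
  unfolding blockwise_def by (rule blk_vec_lambda)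

lemma blockwise_GLmaps:
  assumes "\<And>j. g j \<in> GLmaps"
  shows "blockwise g \<in> GLmaps"
proof -
  have bij: "bij (g j)" and lin: "Vector_Spaces.linear (*s) (*s) (g j)" for j
    using assms unfolding GLmaps_def by blast+
  let ?h = "blockwise (\<lambda>j. inv (g j))"
  have "?h (blockwise g x) = x" and "blockwise g (?h x) = x" for x
    unfolding blk_eq_iff blk_blockwise using bij by (simp_all add: bij_is_inj bij_is_surj surj_f_inv_f)
  then have "bij (blockwise g)" by (metis bijI')
  moreover have "Vector_Spaces.linear (*s) (*s) (blockwise g)"
    by (rule additive_imp_linear_f2vec) (simp add: blk_eq_iff blk_blockwise blk_add vec.linear_add[OF lin])
  ultimately show ?thesis unfolding GLmaps_def by blast
qed

lemma blockwise_par_op: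
  assumes "\<And>j x a. g j (d j x a) = c j (g j x) (g j a)"
  shows "blockwise g (par_op d x a) = par_op c (blockwise g x) (blockwise g a)"
  unfolding blk_eq_iff blk_blockwise blk_par_op using assms by simp

lemma transl_eq_conjgrp:
  assumes "bij G" and hom: "\<And>x a. G (d x a) = c (G x) (G a)"
  shows "transl d = conjgrp G (transl c)"
proof -
  have inv_G: "inv G (G x) = x" and G_inv: "G (inv G x) = x" for x
    using assms(1) by (simp_all add: bij_is_inj bij_is_surj surj_f_inv_f)
  have conj: "(\<lambda>x. d x a) = inv G \<circ> (\<lambda>x. c x (G a)) \<circ> G" for a
    by (simp add: fun_eq_iff hom[symmetric] inv_G)
  show ?thesis
  proof (rule set_eqI, rule iffI)
    fix t assume "t \<in> transl d"
    then obtain a where "t = (\<lambda>x. d x a)" unfolding transl_def by blast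
    then show "t \<in> conjgrp G (transl c)" unfolding conjgrp_def transl_def conj by blast
  next
    fix t assume "t \<in> conjgrp G (transl c)"
    then obtain b where "t = inv G \<circ> (\<lambda>x. c x b) \<circ> G" unfolding conjgrp_def transl_def by blast
    then have "t = (\<lambda>x. d x (inv G b))" by (simp add: conj G_inv)
    then show "t \<in> transl d" unfolding transl_def by blast
  qed
qed

theorem theorem4:
  fixes circ diam :: "'b::finite \<Rightarrow> ('s::finite f2vec \<Rightarrow> 's f2vec \<Rightarrow> 's f2vec)"
  assumes "\<forall>j. is_alt_op (circ j)"
    and "\<forall>j. is_alt_op (diam j)"
    and "\<forall>j. vec.dim (weak_keys (circ j)) + 2 = CARD('s)"
    and "\<forall>j. vec.dim (weak_keys (diam j)) + 2 = CARD('s)"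
  shows "\<exists>g \<in> GLmaps. transl (par_op diam) = conjgrp g (transl (par_op circ))"
proof -
  obtain g where g: "\<And>j. g j \<in> GLmaps"
    and hom: "\<And>j x a. g j (diam j x a) = circ j (g j x) (g j a)"
  proof -
    have "\<forall>j. \<exists>g\<in>GLmaps. \<forall>x a. g (diam j x a) = circ j (g x) (g a)"
      using alt_ops_isomorphic assms by blast
    then show ?thesis using that by metis
  qed
  have G: "blockwise g \<in> GLmaps" using blockwise_GLmaps g .
  then have "transl (par_op diam) = conjgrp (blockwise g) (transl (par_op circ))"
    using transl_eq_conjgrp blockwise_par_op[of g diam circ, OF hom] unfolding GLmaps_def by blast
  with G show ?thesis by blast
qed

end
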